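(* (Riesz's theorem for $L$-lattice ordered groups) Let $(G;e,+,0)$ be an $L$-lattice ordered group and $t\in L$. Let $n\ge 1$ and let $a,b_1,b_2,\ldots,b_n\in G$ be such that $t\le e(0,a)\wedge e(0,b_i)\wedge e(a,b_1+b_2+\cdots+b_n)$ for all $i\in\{1,2,\ldots,n\}$. Then there exist $a_1,a_2,\ldots,a_n\in G$ such that $a=a_1+a_2+\cdots+a_n$ and $t\le e(0,a_i)\wedge e(a_i,b_i)$ for all $i\in\{1,2,\ldots,n\}$.
   Context: $L$ is a fixed frame, i.e. a complete lattice (bottom $0$, top $1$) with $a\wedge\bigvee T=\bigvee_{t\in T}(a\wedge t)$ for all $a\in L$, $T\subseteq L$; put $a\to b=\bigvee\{x\in L\mid a\wedge x\le b\}$. An $L$-ordered set is a pair $(P;e)$ with $e:P\times P\to L$ such that for all $x,y,z\in P$: $e(x,x)=1$; $e(x,y)\wedge e(y,z)\le e(x,z)$; and $e(x,y)=e(y,x)=1$ implies $x=y$. For $S\in L^P$ (a map $P\to L$), $x_0\in P$ is the join $\sqcup S$ if $e(x_0,x)=\bigwedge_{y\in P}(S(y)\to e(y,x))$ for all $x\in P$, and the meet $\sqcap S$ if $e(x,x_0)=\bigwedge_{y\in P}(S(y)\to e(x,y))$ for all $x\in P$; these are unique if they exist. $L^P_\bullet$ is the set of $S\in L^P$ whose support $\{x\in P\mid S(x)>0\}$ is finite and nonempty. $(P;e)$ is an $L$-lattice if $\sqcup S$ and $\sqcap S$ exist for all $S\in L^P_\bullet$. An $L$-ordered group $(G;e,+,0)$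 is a (not necessarily abelian) group $(G;+,0)$ with an $L$-ordered set structure $(G;e)$ such that $e(x,y)\le e(b+x+a,b+y+a)$ for all $x,y,a,b\in G$. It is an $L$-lattice ordered group if moreover $(G;e)$ is an $L$-lattice. *)

theory Defs
  imports Main
begin

unbundle lattice_syntax

(* The library class complete_distrib_lattice demands complete distributivity,
   which is strictly stronger than the frame law. *)
class frame = complete_lattice +
  assumes inf_Sup_frame: "a \<sqinter> \<Squnion>T = (\<Squnion>t\<in>T. a \<sqinter> t)"

definition frame_imp :: "'l::frame \<Rightarrow> 'l \<Rightarrow> 'l" where
  "frame_imp a b = \<Squnion>{x. a \<sqinter> x \<le> b}"

locale L_ordered_set =
  fixes e :: "'p \<Rightarrow> 'p \<Rightarrow> 'l::frame"
  assumes e_refl: "e x x = \<top>"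
    and e_trans: "e x y \<sqinter> e y z \<le> e x z"
    and e_antisym: "e x y = \<top> \<Longrightarrow> e y x = \<top> \<Longrightarrow> x = y"

definition is_L_join :: "('p \<Rightarrow> 'p \<Rightarrow> 'l::frame) \<Rightarrow> ('p \<Rightarrow> 'l) \<Rightarrow> 'p \<Rightarrow> bool" where
  "is_L_join e S x0 \<longleftrightarrow> (\<forall>x. e x0 x = (\<Sqinter>y. frame_imp (S y) (e y x)))"

definition is_L_meet :: "('p \<Rightarrow> 'p \<Rightarrow> 'l::frame) \<Rightarrow> ('p \<Rightarrow> 'l) \<Rightarrow> 'p \<Rightarrow> bool" where
  "is_L_meet e S x0 \<longleftrightarrow> (\<forall>x. e x x0 = (\<Sqinter>y. frame_imp (S y) (e x y)))"

definition L_support :: "('p \<Rightarrow> 'l::frame) \<Rightarrow> 'p set" where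
  "L_support S = {x. S x > \<bottom>}"

locale L_lattice = L_ordered_set e for e :: "'p \<Rightarrow> 'p \<Rightarrow> 'l::frame" +
  assumes join_exists: "finite (L_support S) \<Longrightarrow> L_support S \<noteq> {} \<Longrightarrow> \<exists>x0. is_L_join e S x0"
    and meet_exists: "finite (L_support S) \<Longrightarrow> L_support S \<noteq> {} \<Longrightarrow> \<exists>x0. is_L_meet e S x0"

(* The class group_add does not assume commutativity of addition. *)
locale L_ordered_group = L_ordered_set e for e :: "'g::group_add \<Rightarrow> 'g \<Rightarrow> 'l::frame" +
  assumes e_translate: "e x y \<le> e (b + x + a) (b + y + a)"

locale L_lattice_ordered_group = L_ordered_group e + L_lattice e
  for e :: "'g::group_add \<Rightarrow> 'g \<Rightarrow> 'l::frame"

end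

theory Submission
  imports Defs
begin

text \<open>
  Fix \<open>t\<close> and read \<open>t \<le> e x y\<close> as a translation-invariant preorder. The meet \<open>m\<close> of the crisp pair
  \<open>{x, y}\<close> satisfies \<open>e z m = e z x \<sqinter> e z y\<close>, so it is a greatest lower bound for every such
  preorder simultaneously. The classical argument therefore applies: split off the meet
  of \<open>a\<close> and \<open>b\<^sub>1\<close> and recurse on the rest.
\<close>

lemma frame_imp_top [simp]: "frame_imp \<top> b = b"
proof -
  have "{x. x \<le> b} = {..b}" by auto
  then show ?thesis by (simp add: frame_imp_def)
qed

lemma frame_imp_bot [simp]: "frame_imp \<bottom> b = \<top>"
  by (simp add: frame_imp_def)

lemma (in L_lattice) binary_meet_exists: "\<exists>m. \<forall>z. e z m = e z x \<sqinter> e z y"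
proof (cases "(\<bottom> :: 'l) = \<top>")
  \<comment> \<open>In the one-element frame no element lies strictly above
    \<open>\<bottom>\<close>, so every support is empty and \<open>meet_exists\<close> cannot be
    used. There all values of \<open>e\<close> coincide and any \<open>m\<close> works.\<close>
  case True
  then have "u = v" for u v :: 'l
    by (metis bot.extremum top.extremum order.antisym)
  then show ?thesis by blast
next
  case False
  \<comment> \<open>The crisp pair: weight \<open>\<top>\<close> reduces the implication to
    \<open>e z w\<close>, weight \<open>\<bottom>\<close> makes it \<open>\<top>\<close>, so only
    \<open>x\<close> and \<open>y\<close> contribute to the infimum.\<close>
  define S :: "'p \<Rightarrow> 'l" where "S = (\<lambda>w. if w \<in> {x, y} then \<top> else \<bottom>)"
  have "L_support S = {x, y}"
    using False by (auto simp: L_support_def S_def bot.not_eq_extremum[symmetric])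
  then obtain m where m: "is_L_meet e S m"
    using meet_exists[of S] by auto
  have "(\<Sqinter>w. frame_imp (S w) (e z w)) = e z x \<sqinter> e z y" for z
  proof (rule order.antisym)
    show "(\<Sqinter>w. frame_imp (S w) (e z w)) \<le> e z x \<sqinter> e z y"
      using INF_lower[of x UNIV "\<lambda>w. frame_imp (S w) (e z w)"]
            INF_lower[of y UNIV "\<lambda>w. frame_imp (S w) (e z w)"]
      by (simp add: S_def)
    show "e z x \<sqinter> e z y \<le> (\<Sqinter>w. frame_imp (S w) (e z w))"
      by (rule INF_greatest) (auto simp: S_def)
  qed
  with m show ?thesis unfolding is_L_meet_def by auto
qed

context L_ordered_group
begin

lemma le_e_trans: "t \<le> e x y \<Longrightarrow> t \<le> e y z \<Longrightarrow> t \<le> e x z"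
  using e_trans[of x y z] by (meson le_inf_iff order_trans)

lemma le_e_add_left: "t \<le> e x y \<Longrightarrow> t \<le> e (b + x) (b + y)"
  using e_translate[of x y b 0] by (auto intro: order_trans)

lemma le_e_add_right: "t \<le> e x y \<Longrightarrow> t \<le> e (x + a) (y + a)"
  using e_translate[of x y 0 a] by (auto intro: order_trans)

lemma le_e_sum_list_nonneg:
  assumes "\<forall>b\<in>set bs. t \<le> e 0 b"
  shows "t \<le> e 0 (sum_list bs)"
  using assms
proof (induction bs)
  case Nil
  then show ?case by (simp add: e_refl)
next
  case (Cons b bs)
  have "t \<le> e (b + 0) (b + sum_list bs)"
    using Cons by (intro le_e_add_left) simp
  with Cons.prems show ?case by (auto intro: le_e_trans)
qed

end

text \<open>A list fixes the order of the summands, which matters since addition may be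
  noncommutative. The induction keeps \<open>a\<close> arbitrary because its hypothesis is applied
  to the remainder \<open>- m + a\<close>.\<close>

lemma (in L_lattice_ordered_group) riesz_decomposition_list:
  assumes "bs \<noteq> []" and "t \<le> e 0 a" and "\<forall>b\<in>set bs. t \<le> e 0 b" and "t \<le> e a (sum_list bs)"
  shows "\<exists>cs. a = sum_list cs \<and> list_all2 (\<lambda>c b. t \<le> e 0 c \<sqinter> e c b) cs bs"
  using assms
proof (induction bs arbitrary: a rule: list_nonempty_induct)
  case (single b)
  then show ?case by (intro exI[of _ "[a]"]) simp
next
  case (cons b bs)
  obtain m where m: "\<And>z. e z m = e z a \<sqinter> e z b"
    using binary_meet_exists by blast
  \<comment> \<open>At \<open>z = m\<close> the left side is \<open>e m m = \<top>\<close>, so both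
    meetands are \<open>\<top>\<close>.\<close>
  have m_le: "t \<le> e m a" "t \<le> e m b"
    using m[of m] by (simp_all add: e_refl top.extremum_unique inf_eq_top_iff)
  have m_nonneg: "t \<le> e 0 m"
    using cons.prems m[of 0] by simp
  have rest_nonneg: "t \<le> e 0 (- m + a)"
    using le_e_add_left[OF m_le(1), of "- m"] by simp
  \<comment> \<open>The remainder must lie below \<open>sum_list bs\<close>. This amounts to
    \<open>a - sum_list bs\<close> lying below \<open>m\<close>, hence below both \<open>b\<close>
    and \<open>a\<close>.\<close>
  have "t \<le> e (a - sum_list bs) b"
    using le_e_add_right[OF cons.prems(3), of "- sum_list bs"] by (simp add: add.assoc)
  moreover have "t \<le> e (a - sum_list bs) a"
    using le_e_add_left[OF le_e_add_right[OF le_e_sum_list_nonneg[of bs t], of "- sum_list bs"], of a]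
      cons.prems(2) by simp
  ultimately have "t \<le> e (a - sum_list bs) m"
    using m by simp
  \<comment> \<open>Add \<open>sum_list bs\<close> on the right, then \<open>- m\<close> on the
    left.\<close>
  then have "t \<le> e (- m + a) (sum_list bs)"
    using le_e_add_left[OF le_e_add_right[of t "a - sum_list bs" m "sum_list bs"], of "- m"]
    by (simp add: add.assoc[symmetric])
  then obtain cs where cs: "- m + a = sum_list cs" "list_all2 (\<lambda>c b. t \<le> e 0 c \<sqinter> e c b) cs bs"
    using cons.IH rest_nonneg cons.prems(2) by auto
  have "a = sum_list (m # cs)"
    using cs(1) by (simp flip: cs(1) add: add.assoc[symmetric])
  with cs(2) m_nonneg m_le(2) show ?case
    by (intro exI[of _ "m # cs"]) simp
qed

theorem theorem4p22:
  fixes e :: "'g::group_add \<Rightarrow> 'g \<Rightarrow> 'l::frame"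
    and t :: 'l and n :: nat and a :: 'g and b :: "nat \<Rightarrow> 'g"
  assumes "L_lattice_ordered_group e"
    and "n \<ge> 1"
    and "\<forall>i\<in>{1..n}. t \<le> e 0 a \<sqinter> e 0 (b i) \<sqinter> e a (\<Sum>j\<leftarrow>[1..<n + 1]. b j)"
  shows "\<exists>c :: nat \<Rightarrow> 'g. a = (\<Sum>j\<leftarrow>[1..<n + 1]. c j) \<and>
           (\<forall>i\<in>{1..n}. t \<le> e 0 (c i) \<sqinter> e (c i) (b i))"
proof -
  interpret L_lattice_ordered_group e by fact
  let ?bs = "map b [1..<n + 1]"
  \<comment> \<open>The bounds on \<open>a\<close> stand under the quantifier over \<open>i\<close>,
    so some index is needed to extract them.\<close>
  have "1 \<in> {1..n}" using assms(2) by simp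
  with assms(3) have "t \<le> e 0 a" "t \<le> e a (sum_list ?bs)" by (auto simp del: upt_Suc)
  moreover have "\<forall>x\<in>set ?bs. t \<le> e 0 x" using assms(3) by (auto simp del: upt_Suc)
  moreover have "?bs \<noteq> []" using assms(2) by simp
  ultimately obtain cs where cs: "a = sum_list cs"
    and all: "list_all2 (\<lambda>c b. t \<le> e 0 c \<sqinter> e c b) cs ?bs"
    using riesz_decomposition_list by blast
  have len: "length cs = n" using list_all2_lengthD[OF all] by simp
  \<comment> \<open>The family is indexed from 1, list positions from 0.\<close>
  have "map (\<lambda>j. cs ! (j - 1)) [1..<n + 1] = cs"
    using len by (intro nth_equalityI) (simp_all del: upt_Suc)
  moreover have "t \<le> e 0 (cs ! (i - 1)) \<sqinter> e (cs ! (i - 1)) (b i)" if "i \<in> {1..n}" for i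
    using list_all2_nthD[OF all, of "i - 1"] that len by (auto simp del: upt_Suc)
  ultimately show ?thesis
    using cs by (intro exI[of _ "\<lambda>j. cs ! (j - 1)"]) (simp del: upt_Suc)
qed

end
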